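(* Let $a,b>0$ and consider the Genesio--Tesi system, i.e. the vector field on $\mathbb{R}^3$ given by $$\dot{x}=y,\qquad \dot{y}=z,\qquad \dot{z}=-az-by-x(1+x).$$ Then both of its fixed points $(-1,0,0)$ and $(0,0,0)$ are connected by one-dimensional invariant manifolds to $\infty$.
   Context: $\infty$ denotes the point added in $S^3=\mathbb{R}^3\cup\{\infty\}$. A one-dimensional invariant manifold of a fixed point $p$ connecting it to $\infty$ is a flow-invariant curve (an unbounded flow line) whose two ends in $S^3$ are $p$ and $\infty$. *)

theory Defs
  imports "HOL-Analysis.Analysis"
begin

definition Genesio_Tesi :: "real \<Rightarrow> real \<Rightarrow> real^3 \<Rightarrow> real^3" where
  "Genesio_Tesi a b p =
     (let x = p $ 1; y = p $ 2; z = p $ 3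
      in vector [y, z, - a * z - b * y - x * (1 + x)])"

(* Time intervals have extended real endpoints: orbits may blow up in finite time. *)
definition integral_curve ::
    "(real^3 \<Rightarrow> real^3) \<Rightarrow> ereal \<Rightarrow> ereal \<Rightarrow> (real \<Rightarrow> real^3) \<Rightarrow> bool" where
  "integral_curve F \<alpha> \<omega> \<gamma> \<longleftrightarrow>
     \<alpha> < \<omega> \<and> (\<forall>t\<in>einterval \<alpha> \<omega>. (\<gamma> has_vector_derivative F (\<gamma> t)) (at t))"

definition maximal_integral_curve ::
    "(real^3 \<Rightarrow> real^3) \<Rightarrow> ereal \<Rightarrow> ereal \<Rightarrow> (real \<Rightarrow> real^3) \<Rightarrow> bool" where
  "maximal_integral_curve F \<alpha> \<omega> \<gamma> \<longleftrightarrow>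
     integral_curve F \<alpha> \<omega> \<gamma> \<and>
     (\<forall>\<alpha>' \<omega>' \<delta>. \<alpha>' \<le> \<alpha> \<and> \<omega> \<le> \<omega>' \<and> integral_curve F \<alpha>' \<omega>' \<delta> \<and>
        (\<forall>t\<in>einterval \<alpha> \<omega>. \<delta> t = \<gamma> t) \<longrightarrow> \<alpha>' = \<alpha> \<and> \<omega>' = \<omega>)"

(* The three-sphere as the one-point compactification of Euclidean space:
   None is the point at infinity, Some p is the point p. *)
abbreviation S3 :: "(real^3) option topology" where
  "S3 \<equiv> Alexandroff_compactification euclidean"

definition backward_end :: "ereal \<Rightarrow> (real \<Rightarrow> real^3) \<Rightarrow> (real^3) option \<Rightarrow> bool" where
  "backward_end \<alpha> \<gamma> q \<longleftrightarrow> limitin S3 (Some \<circ> \<gamma> \<circ> real_of_ereal) q (at_right \<alpha>)"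

definition forward_end :: "ereal \<Rightarrow> (real \<Rightarrow> real^3) \<Rightarrow> (real^3) option \<Rightarrow> bool" where
  "forward_end \<omega> \<gamma> q \<longleftrightarrow> limitin S3 (Some \<circ> \<gamma> \<circ> real_of_ereal) q (at_left \<omega>)"

(* The flow may run along the curve in either direction. The curve is not constant,
   since its two ends differ, so it is one-dimensional. *)
definition connected_to_infinity :: "(real^3 \<Rightarrow> real^3) \<Rightarrow> real^3 \<Rightarrow> bool" where
  "connected_to_infinity F p \<longleftrightarrow>
     F p = 0 \<and>
     (\<exists>\<alpha> \<omega> \<gamma>. maximal_integral_curve F \<alpha> \<omega> \<gamma> \<and>
        (backward_end \<alpha> \<gamma> (Some p) \<and> forward_end \<omega> \<gamma> None \<or>
         backward_end \<alpha> \<gamma> None \<and> forward_end \<omega> \<gamma> (Some p)))"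

lemma limitin_S3_None_iff:
  "limitin S3 (Some \<circ> f) None G \<longleftrightarrow> filterlim f at_infinity G"
proof
  assume L: "limitin S3 (Some \<circ> f) None G"
  show "filterlim f at_infinity G"
    unfolding filterlim_at_infinity[OF order_refl]
  proof (intro allI impI)
    fix r :: real assume "0 < r"
    have "openin S3 (insert None (Some ` (UNIV - cball 0 r)))"
      unfolding openin_Alexandroff_compactification
      by (intro disjI2 exI[of _ "cball 0 r"]) simp
    then have "\<forall>\<^sub>F t in G. (Some \<circ> f) t \<in> insert None (Some ` (UNIV - cball 0 r))"
      using L by (auto simp: limitin_def)
    then show "\<forall>\<^sub>F t in G. r \<le> norm (f t)"
      by eventually_elim auto
  qed
next
  assume L: "filterlim f at_infinity G"
  show "limitin S3 (Some \<circ> f) None G"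
    unfolding limitin_def
  proof (intro conjI allI impI)
    fix U assume "openin S3 U \<and> (None :: (real^3) option) \<in> U"
    then obtain C where C: "compact C" "U = insert None (Some ` (UNIV - C))"
      by (auto simp: openin_Alexandroff_compactification)
    then obtain B where B: "\<forall>x\<in>C. norm x \<le> B"
      using compact_imp_bounded bounded_iff by metis
    have "\<forall>\<^sub>F t in G. \<bar>B\<bar> + 1 \<le> norm (f t)"
      using L filterlim_at_infinity[OF order_refl, of f G] by force
    then show "\<forall>\<^sub>F t in G. (Some \<circ> f) t \<in> U"
      by eventually_elim (use B C in force)
  qed simp
qed

lemma limitin_S3_Some_iff:
  "limitin S3 (Some \<circ> f) (Some p) G \<longleftrightarrow> (f \<longlongrightarrow> p) G"
  using limitin_canonical_iff[of f p G]
  by (auto simp: limitin_def openin_Alexandroff_compactification tendsto_def image_iff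
      dest!: spec[of _ "Some ` _"])

end

theory Submission
  imports Defs "HOL-Real_Asymp.Real_Asymp"
begin

text \<open>
  In the first coordinate the system is the scalar equation x''' + a x'' + b x' + x + x^2 = 0.
  Put x = -1 - u to look at the fixed point (-1,0,0), and x(t) = u(-t) to look at the origin with
  time reversed. Both substitutions lead to the same equation
    u''' + A u'' + B u' = u + u^2,
  with A = a in the first case, A = -a in the second, and B = b in both. So it suffices to find,
  for arbitrary real A and B, a solution with u, u', u'' tending to 0 at time -\<infinity> and u tending to
  \<infinity> at the end of its life.

  Such a solution is the exponential series u(t) = \<Sum> c_n e^{n r t} with c_1 = 1, where r is the
  largest real root of P(s) = s^3 + A s^2 + B s - 1. It is positive because P(0) = -1.
  Comparing coefficients gives P(n r) c_n = \<Sum> c_i c_{n-i}. As P is positive beyond r, there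
  is no resonance and all c_n are nonnegative. This sign is what makes the argument work. It makes u
  increasing, and a power series with nonnegative coefficients that stays bounded up to its
  finite radius of convergence R converges at R. Since moreover P(n r) tends to \<infinity>, the
  recursion turns convergence at R into convergence beyond R
  (lemma bounded_partial_sums_extend), which is absurd. So u is unbounded as e^{r t} tends to R.
  If R is infinite, u is unbounded because u \<ge> e^{r t}. The same extension lemma,
  started at the point 0, shows that R > 0.

  The orbit is maximal because it has no limit in \<real>^3 at an endpoint that is finite, so no
  integral curve continues it past that endpoint. The orbits being explicit, existence and
  continuation theorems for differential equations do not enter.
\<close>

section \<open>Exponential series solving a third-order equation with a quadratic term\<close>

text \<open>
  The largest root is chosen so that no multiple n r with n \<ge> 2 is again a root, even when the cubic
  has several positive roots.
\<close>

lemma largest_root_cubic: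
  fixes A B :: real
  defines "P \<equiv> \<lambda>s. s ^ 3 + A * s\<^sup>2 + B * s - 1"
  obtains r where "r > 0" "P r = 0" "\<And>s. s > r \<Longrightarrow> P s > 0"
    "filterlim (\<lambda>n. P (real n * r)) at_top sequentially"
proof -
  have top: "filterlim P at_top at_top"
    unfolding P_def by real_asymp
  have cont: "isCont P s" for s
    unfolding P_def by (intro continuous_intros)
  define S where "S = {s. P s \<le> 0}"
  have P0: "P 0 = - 1" by (simp add: P_def)
  obtain M where M: "\<And>s. s \<ge> M \<Longrightarrow> P s > 0"
    using top by (auto simp: filterlim_at_top_dense eventually_at_top_linorder)
  have bdd: "bdd_above S"
  proof (rule bdd_aboveI)
    show "s \<le> M" if "s \<in> S" for s
      using M[of s] that unfolding S_def by (cases "s \<le> M") auto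
  qed
  have "closed S"
    unfolding S_def P_def by (intro closed_Collect_le continuous_intros)
  moreover have ne: "0 \<in> S" by (simp add: S_def P0)
  ultimately have mem: "Sup S \<in> S"
    using bdd by (intro closed_contains_Sup) auto
  define r where "r = Sup S"
  have above: "P s > 0" if "s > r" for s
    using cSup_upper[OF _ bdd, of s] that by (force simp: r_def S_def)
  have "P r \<ge> 0"
  proof (rule tendsto_lowerbound)
    show "(P \<longlongrightarrow> P r) (at_right r)"
      using cont by (simp add: isCont_def filterlim_at_split)
    show "\<forall>\<^sub>F s in at_right r. 0 \<le> P s"
      using above by (auto simp: eventually_at_filter less_imp_le)
  qed simp
  with mem have root: "P r = 0" by (simp add: S_def r_def)
  have "r \<ge> 0" using cSup_upper[OF ne bdd] by (simp add: r_def)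
  moreover have "r \<noteq> 0" using root P0 by auto
  ultimately have pos: "r > 0" by simp
  have "filterlim (\<lambda>n. real n * r) at_top sequentially"
    using pos by real_asymp
  from filterlim_compose[OF top this] show ?thesis
    using that[OF pos root above] by simp
qed

text \<open>
  The coefficients of the formal solution of L u = u^2 with u = w + O(w^2), where L is the diagonal
  operator that multiplies w^n by k n. The constant term is 0, so that the solution starts at the
  fixed point.
\<close>

fun quad_coeff :: "(nat \<Rightarrow> real) \<Rightarrow> nat \<Rightarrow> real" where
  "quad_coeff k n = (if n \<le> 1 then real n
     else (\<Sum>i\<in>{1..<n}. quad_coeff k i * quad_coeff k (n - i)) / k n)"

(* The recursion equation is not guarded by a pattern, so the simplifier would unfold it forever. *)
declare quad_coeff.simps [simp del]

lemma quad_coeff_0 [simp]: "quad_coeff k 0 = 0"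
  and quad_coeff_1 [simp]: "quad_coeff k (Suc 0) = 1"
  by (simp_all add: quad_coeff.simps)

lemma quad_coeff_nonneg:
  assumes "\<And>n. n \<ge> 2 \<Longrightarrow> k n > 0"
  shows "quad_coeff k n \<ge> 0"
proof (induction n rule: less_induct)
  case (less n)
  show ?case
    by (subst quad_coeff.simps)
      (auto intro!: divide_nonneg_nonneg sum_nonneg mult_nonneg_nonneg less
        less_imp_le[OF assms])
qed

lemma quad_coeff_convolution:
  assumes "k 1 = 0" "\<And>n. n \<ge> 2 \<Longrightarrow> k n > 0"
  shows "k n * quad_coeff k n = (\<Sum>i\<le>n. quad_coeff k i * quad_coeff k (n - i))"
proof -
  consider "n = 0" | "n = 1" | "n \<ge> 2" by linarith
  then show ?thesis
  proof cases
    case 3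
    have "k n * quad_coeff k n = (\<Sum>i\<in>{1..<n}. quad_coeff k i * quad_coeff k (n - i))"
      using 3 assms(2)[of n] by (subst quad_coeff.simps) simp
    also have "\<dots> = (\<Sum>i\<le>n. quad_coeff k i * quad_coeff k (n - i))"
    proof (rule sum.mono_neutral_left)
      have "i = 0 \<or> i = n" if "i \<in> {..n} - {1..<n}" for i
        using that by auto
      then show "\<forall>i\<in>{..n} - {1..<n}. quad_coeff k i * quad_coeff k (n - i) = 0"
        by fastforce
    qed auto
    finally show ?thesis .
  qed (use assms(1) in simp_all)
qed

text \<open>
  Because c 0 = 0, the Cauchy product bounds the next partial sum G' by the previous one:
  G' \<le> H + G^2 / \<delta>, where H is the sum of the terms of index at most m. If H \<le> \<delta> / 4, the
  interval [0, \<delta> / 2] is invariant under this step.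
\<close>

lemma partial_sums_bootstrap:
  fixes c :: "nat \<Rightarrow> real"
  assumes c0: "c 0 = 0" and nonneg: "\<And>n. c n \<ge> 0"
    and "w \<ge> 0" and "\<delta> > 0"
    and conv: "\<And>n. n > m \<Longrightarrow> \<delta> * c n \<le> (\<Sum>i\<le>n. c i * c (n - i))"
    and head: "4 * (\<Sum>n\<le>m. c n * w ^ n) \<le> \<delta>"
  shows "2 * (\<Sum>n\<le>N. c n * w ^ n) \<le> \<delta>"
proof (induction N)
  case 0
  show ?case using c0 \<open>\<delta> > 0\<close> by simp
next
  case (Suc N)
  define G where "G = (\<Sum>n\<le>N. c n * w ^ n)"
  define H where "H = (\<Sum>n\<le>m. c n * w ^ n)"
  let ?T = "{n. m < n \<and> n \<le> Suc N}"
  have term_nonneg: "0 \<le> c n * w ^ n" for n using nonneg \<open>w \<ge> 0\<close> by simp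
  have split: "(\<Sum>n\<le>Suc N. c n * w ^ n) \<le> H + (\<Sum>n\<in>?T. c n * w ^ n)"
  proof -
    have "(\<Sum>n\<le>Suc N. c n * w ^ n) \<le> (\<Sum>n\<in>{..m} \<union> ?T. c n * w ^ n)"
      by (rule sum_mono2) (auto simp: term_nonneg)
    also have "\<dots> = H + (\<Sum>n\<in>?T. c n * w ^ n)"
      unfolding H_def by (rule sum.union_disjoint) auto
    finally show ?thesis .
  qed
  have "\<delta> * (\<Sum>n\<in>?T. c n * w ^ n) = (\<Sum>n\<in>?T. \<delta> * c n * w ^ n)"
    by (simp add: sum_distrib_left mult.assoc)
  also have "\<dots> \<le> (\<Sum>n\<in>?T. \<Sum>i\<le>n. (c i * w ^ i) * (c (n - i) * w ^ (n - i)))"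
  proof (rule sum_mono)
    fix n assume "n \<in> ?T"
    then have "\<delta> * c n * w ^ n \<le> (\<Sum>i\<le>n. c i * c (n - i)) * w ^ n"
      using conv \<open>w \<ge> 0\<close> by (intro mult_right_mono) auto
    also have "\<dots> = (\<Sum>i\<le>n. (c i * w ^ i) * (c (n - i) * w ^ (n - i)))"
      unfolding sum_distrib_right
      by (rule sum.cong) (simp_all add: mult_ac flip: power_add)
    finally show "\<delta> * c n * w ^ n \<le> \<dots>" .
  qed
  also have "\<dots> = (\<Sum>(n, i)\<in>Sigma ?T (\<lambda>n. {..n}). (c i * w ^ i) * (c (n - i) * w ^ (n - i)))"
    by (rule sum.Sigma) auto
  also have "\<dots> = (\<Sum>(n, i)\<in>Sigma ?T (\<lambda>n. {1..<n}). (c i * w ^ i) * (c (n - i) * w ^ (n - i)))"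
  proof (rule sum.mono_neutral_right)
    have "i = 0 \<or> i = n" if "i \<le> n" "\<not> (1 \<le> i \<and> i < n)" for i n :: nat
      using that by auto
    then show "\<forall>x\<in>Sigma ?T (\<lambda>n. {..n}) - Sigma ?T (\<lambda>n. {1..<n}).
        (case x of (n, i) \<Rightarrow> (c i * w ^ i) * (c (n - i) * w ^ (n - i))) = 0"
      using c0 by fastforce
  qed auto
  also have "\<dots> = (\<Sum>(i, j)\<in>(\<lambda>(n, i). (i, n - i)) ` Sigma ?T (\<lambda>n. {1..<n}).
      (c i * w ^ i) * (c j * w ^ j))"
    by (subst sum.reindex) (auto simp: inj_on_def case_prod_unfold)
  also have "\<dots> \<le> (\<Sum>(i, j)\<in>{..N} \<times> {..N}. (c i * w ^ i) * (c j * w ^ j))"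
    by (rule sum_mono2) (auto intro!: mult_nonneg_nonneg simp: nonneg \<open>w \<ge> 0\<close>)
  also have "\<dots> = G * G"
    by (simp add: G_def sum_product sum.cartesian_product)
  finally have tail: "\<delta> * (\<Sum>n\<in>?T. c n * w ^ n) \<le> G * G" .
  have "0 \<le> G" unfolding G_def by (intro sum_nonneg term_nonneg)
  moreover have "2 * G \<le> \<delta>" using Suc by (simp add: G_def)
  ultimately have "4 * (G * G) \<le> \<delta> * \<delta>"
    using mult_mono[of "2 * G" \<delta> "2 * G" \<delta>] by simp
  then have "\<delta> * (4 * (\<Sum>n\<in>?T. c n * w ^ n)) \<le> \<delta> * \<delta>"
    using tail by simp
  then have "4 * (\<Sum>n\<in>?T. c n * w ^ n) \<le> \<delta>"
    using \<open>\<delta> > 0\<close> by (simp only: mult_le_cancel_left_pos)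
  then show ?case using split head by (simp add: H_def)
qed

text \<open>
  Compared with the bound S, the factor k n is large for all but finitely many n. These finitely many
  terms depend continuously on w, so the bootstrap still applies slightly to the right of w0. At the
  boundary of the disc of convergence this is the blow-up argument. At w0 = 0 it says that the
  radius of convergence is positive.
\<close>

lemma bounded_partial_sums_extend:
  fixes c :: "nat \<Rightarrow> real"
  assumes c0: "c 0 = 0" and nonneg: "\<And>n. c n \<ge> 0"
    and k: "filterlim k at_top sequentially"
    and conv: "\<And>n. k n * c n = (\<Sum>i\<le>n. c i * c (n - i))"
    and "w0 \<ge> 0" and bound: "\<And>N. (\<Sum>n\<le>N. c n * w0 ^ n) \<le> S"
  shows "\<exists>w>w0. summable (\<lambda>n. c n * w ^ n)"
proof -
  define \<delta> where "\<delta> = 4 * (\<bar>S\<bar> + 1)"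
  have "\<delta> > 0" by (simp add: \<delta>_def)
  obtain m where m: "\<And>n. n \<ge> m \<Longrightarrow> k n \<ge> \<delta>"
    using k by (auto simp: filterlim_at_top eventually_sequentially)
  have "((\<lambda>w. \<Sum>n\<le>m. c n * w ^ n) \<longlongrightarrow> (\<Sum>n\<le>m. c n * w0 ^ n)) (at_right w0)"
    by (intro tendsto_intros)
  moreover have "(\<Sum>n\<le>m. c n * w0 ^ n) < \<bar>S\<bar> + 1"
    using bound[of m] by linarith
  ultimately have "\<forall>\<^sub>F w in at_right w0. (\<Sum>n\<le>m. c n * w ^ n) < \<bar>S\<bar> + 1"
    by (rule order_tendstoD)
  moreover have "\<forall>\<^sub>F w in at_right w0. w > w0"
    by (simp add: eventually_at_filter)
  ultimately have "\<forall>\<^sub>F w in at_right w0. (\<Sum>n\<le>m. c n * w ^ n) < \<bar>S\<bar> + 1 \<and> w > w0"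
    by (rule eventually_conj)
  then obtain w where w: "(\<Sum>n\<le>m. c n * w ^ n) < \<bar>S\<bar> + 1" "w > w0"
    using eventually_happens trivial_limit_at_right_real by blast
  have "w \<ge> 0" using w \<open>w0 \<ge> 0\<close> by simp
  have sums: "2 * (\<Sum>n\<le>N. c n * w ^ n) \<le> \<delta>" for N
  proof (rule partial_sums_bootstrap[of c w \<delta> m])
    fix n assume "n > m"
    then have "\<delta> * c n \<le> k n * c n"
      using m nonneg by (intro mult_right_mono) auto
    then show "\<delta> * c n \<le> (\<Sum>i\<le>n. c i * c (n - i))" by (simp add: conv)
  next
    show "4 * (\<Sum>n\<le>m. c n * w ^ n) \<le> \<delta>" using w by (simp add: \<delta>_def)
  qed (use c0 nonneg \<open>w \<ge> 0\<close> \<open>\<delta> > 0\<close> in auto)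
  have "summable (\<lambda>n. c n * w ^ n)"
  proof (rule bounded_imp_summable)
    show "(\<Sum>n\<le>N. c n * w ^ n) \<le> \<delta> / 2" for N using sums[of N] by simp
  qed (use nonneg \<open>w \<ge> 0\<close> in simp)
  with w show ?thesis by blast
qed

text \<open>
  Under the substitution w = e^{l t}, differentiation in t becomes l times the Euler operator
  w d/dw, which acts diagonally on power series. This turns the differential equation into the
  recursion for the coefficients.
\<close>

lemma fps_XD_conv_radius: "fps_conv_radius f \<le> fps_conv_radius (fps_const l * fps_XD f)"
  for l :: real
proof -
  have "fps_conv_radius f \<le> fps_conv_radius (fps_XD f)"
    using fps_conv_radius_mult[of fps_X "fps_deriv f"] fps_conv_radius_deriv[of f]
    by (simp add: fps_XD_def)
  also have "\<dots> \<le> fps_conv_radius (fps_const l * fps_XD f)"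
    using fps_conv_radius_mult[of "fps_const l" "fps_XD f"] by simp
  finally show ?thesis .
qed

lemma has_derivative_exp_series:
  fixes f :: "real fps"
  assumes "ereal (exp (l * t)) < fps_conv_radius f"
  shows "((\<lambda>t. eval_fps f (exp (l * t))) has_real_derivative
    eval_fps (fps_const l * fps_XD f) (exp (l * t))) (at t)"
proof -
  have rad: "norm (exp (l * t)) < fps_conv_radius f" using assms by simp
  then have d: "norm (exp (l * t)) < fps_conv_radius (fps_deriv f)"
    using fps_conv_radius_deriv[of f] by (rule less_le_trans)
  have XD: "norm (exp (l * t)) < fps_conv_radius (fps_XD f)"
    using rad fps_XD_conv_radius[of f 1] by simp
  have "eval_fps (fps_const l * fps_XD f) (exp (l * t)) =
      eval_fps (fps_deriv f) (exp (l * t)) * (exp (l * t) * l)"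
    using d XD by (simp add: eval_fps_mult fps_XD_def)
  moreover have "((\<lambda>t. eval_fps f (exp (l * t))) has_real_derivative
      eval_fps (fps_deriv f) (exp (l * t)) * (exp (l * t) * l)) (at t)"
    by (rule DERIV_chain2[where f = "eval_fps f" and g = "\<lambda>t. exp (l * t)"])
      (auto intro!: has_field_derivative_eval_fps[OF rad] derivative_eq_intros)
  ultimately show ?thesis by simp
qed

lemma exp_series_tendsto_0:
  fixes f :: "real fps"
  assumes "fps_conv_radius f > 0" "fps_nth f 0 = 0" "l > 0"
  shows "((\<lambda>t. eval_fps f (exp (l * t))) \<longlongrightarrow> 0) at_bot"
proof -
  have "isCont (eval_fps f) 0"
    using assms(1) by (intro continuous_eval_fps) (simp add: zero_ereal_def)
  moreover have "((\<lambda>t. exp (l * t)) \<longlongrightarrow> 0) at_bot"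
    using \<open>l > 0\<close> by real_asymp
  ultimately have "((\<lambda>t. eval_fps f (exp (l * t))) \<longlongrightarrow> eval_fps f 0) at_bot"
    by (rule isCont_tendsto_compose)
  then show ?thesis by (simp add: eval_fps_at_0 assms)
qed

lemma unbounded_exponential_solution:
  fixes A B :: real
  obtains \<omega> :: ereal and u u' u'' :: "real \<Rightarrow> real" where
    "-\<infinity> < \<omega>"
    "\<And>t. ereal t < \<omega> \<Longrightarrow> (u has_real_derivative u' t) (at t)"
    "\<And>t. ereal t < \<omega> \<Longrightarrow> (u' has_real_derivative u'' t) (at t)"
    "\<And>t. ereal t < \<omega> \<Longrightarrow> (u'' has_real_derivative
        u t + (u t)\<^sup>2 - A * u'' t - B * u' t) (at t)"
    "(u \<longlongrightarrow> 0) at_bot" "(u' \<longlongrightarrow> 0) at_bot" "(u'' \<longlongrightarrow> 0) at_bot"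
    "filterlim (u \<circ> real_of_ereal) at_top (at_left \<omega>)"
proof -
  define P where "P s = s ^ 3 + A * s\<^sup>2 + B * s - 1" for s :: real
  obtain l where l: "l > 0" "P l = 0" "\<And>s. s > l \<Longrightarrow> P s > 0"
      "filterlim (\<lambda>n. P (real n * l)) at_top sequentially"
    unfolding P_def by (rule largest_root_cubic[of A B]) blast
  define k where "k n = P (real n * l)" for n
  have k_pos: "k n > 0" if "n \<ge> 2" for n
    unfolding k_def using that l(1) by (intro l(3)) simp
  have k_1: "k 1 = 0" using l(2) by (simp add: k_def)
  have k_top: "filterlim k at_top sequentially"
    using l(4) by (simp add: k_def[abs_def])
  define c where "c = quad_coeff k"
  have c0: "c 0 = 0" and c1: "c 1 = 1" by (simp_all add: c_def)
  have c_nonneg: "c n \<ge> 0" for n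
    unfolding c_def by (rule quad_coeff_nonneg[OF k_pos])
  have c_conv: "k n * c n = (\<Sum>i\<le>n. c i * c (n - i))" for n
    unfolding c_def using k_1 k_pos by (rule quad_coeff_convolution)
  note extend = bounded_partial_sums_extend[of c k, OF c0 c_nonneg k_top c_conv]
  define f where "f = Abs_fps c"
  define R where "R = fps_conv_radius f"
  have f_nth [simp]: "fps_nth f n = c n" for n by (simp add: f_def)
  have R_ge: "ereal w \<le> R" if "summable (\<lambda>n. c n * w ^ n)" "w > 0" for w
    using conv_radius_geI[of c w] that by (simp add: R_def fps_conv_radius_def f_def)
  have "\<exists>w>0. summable (\<lambda>n. c n * w ^ n)"
  proof (rule extend)
    show "(\<Sum>n\<le>N. c n * 0 ^ n) \<le> 0" for N
      by (intro sum_nonpos) (simp add: c0 power_0_left)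
  qed simp
  then obtain w where w: "w > 0" "ereal w \<le> R" using R_ge by blast
  then have R_pos: "R > 0" by (metis ereal_less(2) less_le_trans)
  \<comment> \<open>The lifetime ends when e^{l t} reaches the radius of convergence.\<close>
  define \<omega> where "\<omega> = (if R = \<infinity> then \<infinity> else ereal (ln (real_of_ereal R) / l))"
  have \<omega>_iff: "ereal t < \<omega> \<longleftrightarrow> ereal (exp (l * t)) < R" for t
  proof (cases R)
    case (real r)
    then have "r > 0" using R_pos by simp
    have "t < ln r / l \<longleftrightarrow> l * t < ln r" using l(1) by (simp add: field_simps)
    also have "\<dots> \<longleftrightarrow> exp (l * t) < r"
      using \<open>r > 0\<close> by (metis exp_less_cancel_iff exp_ln)
    finally show ?thesis using real by (simp add: \<omega>_def)
  qed (use R_pos in \<open>auto simp: \<omega>_def\<close>)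
  define D where "D g = fps_const l * fps_XD g" for g :: "real fps"
  have rad_D: "fps_conv_radius g \<le> fps_conv_radius (D g)" for g
    unfolding D_def by (rule fps_XD_conv_radius)
  have rad: "R \<le> fps_conv_radius f" "R \<le> fps_conv_radius (D f)"
      "R \<le> fps_conv_radius (D (D f))" "R \<le> fps_conv_radius (D (D (D f)))"
    unfolding R_def
    using rad_D[of f] rad_D[of "D f"] rad_D[of "D (D f)"] by (auto intro: order_trans)
  define u where "u t = eval_fps f (exp (l * t))" for t
  define u' where "u' t = eval_fps (D f) (exp (l * t))" for t
  define u'' where "u'' t = eval_fps (D (D f)) (exp (l * t))" for t
  have deriv: "((\<lambda>t. eval_fps g (exp (l * t))) has_real_derivative
      eval_fps (D g) (exp (l * t))) (at t)"
    if "ereal t < \<omega>" "R \<le> fps_conv_radius g" for t g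
    unfolding D_def using that \<omega>_iff by (intro has_derivative_exp_series) auto
  have series_eq: "D (D (D f)) + fps_const A * D (D f) + fps_const B * D f - f = f * f"
  proof (rule fps_ext)
    fix n
    have "fps_nth (D (D (D f)) + fps_const A * D (D f) + fps_const B * D f - f) n = k n * c n"
      by (simp add: D_def k_def P_def algebra_simps power2_eq_square power3_eq_cube)
    also have "\<dots> = fps_nth (f * f) n"
      by (simp add: c_conv fps_mult_nth atLeast0AtMost)
    finally show "fps_nth (D (D (D f)) + fps_const A * D (D f) + fps_const B * D f - f) n
        = fps_nth (f * f) n" .
  qed
  have third: "eval_fps (D (D (D f))) (exp (l * t)) = u t + (u t)\<^sup>2 - A * u'' t - B * u' t"
    if "ereal t < \<omega>" for t
  proof -
    let ?w = "exp (l * t)"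
    have in_disc: "norm ?w < fps_conv_radius g" if "R \<le> fps_conv_radius g" for g
      using \<open>ereal t < \<omega>\<close> \<omega>_iff that by auto
    note d = rad[THEN in_disc]
    have mult_rad: "norm ?w < fps_conv_radius (g * h)"
      if "norm ?w < fps_conv_radius g" "norm ?w < fps_conv_radius h" for g h :: "real fps"
      using fps_conv_radius_mult[of g h] that by (meson less_le_trans min_less_iff_conj)
    have add_rad: "norm ?w < fps_conv_radius (g + h)"
      if "norm ?w < fps_conv_radius g" "norm ?w < fps_conv_radius h" for g h :: "real fps"
      using fps_conv_radius_add[of g h] that by (meson less_le_trans min_less_iff_conj)
    have const_rad: "norm ?w < fps_conv_radius (fps_const x)" for x :: real by simp
    note rads = d mult_rad add_rad const_rad
    have "u t * u t = eval_fps (f * f) ?w"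
      unfolding u_def by (intro eval_fps_mult[symmetric] rads)
    also have "\<dots> = eval_fps (D (D (D f))) ?w + A * u'' t + B * u' t - u t"
      unfolding series_eq[symmetric]
      by (subst eval_fps_diff eval_fps_add eval_fps_mult; (intro rads)?)+
        (simp add: u_def u'_def u''_def)
    finally show ?thesis by (simp add: power2_eq_square)
  qed
  have partial_le: "(\<Sum>n\<le>N. c n * exp (l * t) ^ n) \<le> u t" if "ereal t < \<omega>" for N t
    unfolding u_def eval_fps_def f_nth
  proof (rule sum_le_suminf)
    show "summable (\<lambda>n. c n * exp (l * t) ^ n)"
      using summable_fps[of "exp (l * t)" f] that by (simp add: \<omega>_iff R_def)
  qed (simp_all add: c_nonneg)
  have mono: "u s \<le> u t" if "s \<le> t" "ereal t < \<omega>" for s t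
    unfolding u_def eval_fps_def f_nth
  proof (rule suminf_le)
    fix n
    show "c n * exp (l * s) ^ n \<le> c n * exp (l * t) ^ n"
      using that l(1) c_nonneg by (intro mult_left_mono power_mono) auto
  next
    have "ereal s < \<omega>" using that by (meson ereal_less_eq(3) le_less_trans)
    then show "summable (\<lambda>n. c n * exp (l * s) ^ n)" "summable (\<lambda>n. c n * exp (l * t) ^ n)"
      using summable_fps[of "exp (l * s)" f] summable_fps[of "exp (l * t)" f] that
      by (simp_all add: \<omega>_iff R_def)
  qed
  have unbounded: "\<exists>t. ereal t < \<omega> \<and> M < u t" for M
  proof (rule ccontr)
    assume "\<not> ?thesis"
    then have M: "u t \<le> M" if "ereal t < \<omega>" for t using that by (meson not_le)
    have le_M: "(\<Sum>n\<le>N. c n * v ^ n) \<le> M" if "0 < v" "ereal v < R" for N v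
    proof -
      have "exp (l * (ln v / l)) = v" using that(1) l(1) by simp
      then show ?thesis
        using partial_le[of "ln v / l" N] M[of "ln v / l"] that(2) by (simp add: \<omega>_iff)
    qed
    show False
    proof (cases R)
      case (real r)
      then have "r > 0" using R_pos by simp
      have "(\<Sum>n\<le>N. c n * r ^ n) \<le> M" for N
      proof (rule tendsto_upperbound)
        show "((\<lambda>v. \<Sum>n\<le>N. c n * v ^ n) \<longlongrightarrow> (\<Sum>n\<le>N. c n * r ^ n)) (at_left r)"
          by (intro tendsto_intros)
        show "\<forall>\<^sub>F v in at_left r. (\<Sum>n\<le>N. c n * v ^ n) \<le> M"
          using eventually_at_left_real[OF \<open>r > 0\<close>]
          by eventually_elim (use real in \<open>auto intro: le_M\<close>)
      qed simp
      \<comment> \<open>By positivity, boundedness inside the disc persists on its boundary, hence beyond it.\<close>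
      then obtain v where v: "v > r" "summable (\<lambda>n. c n * v ^ n)"
        using extend[of r M] \<open>r > 0\<close> by auto
      then show False using R_ge[of v] real \<open>r > 0\<close> by simp
    next
      case PInf
      have "c 0 * (\<bar>M\<bar> + 1) ^ 0 + c 1 * (\<bar>M\<bar> + 1) ^ 1 \<le> M"
        using le_M[of "\<bar>M\<bar> + 1" 1] PInf by simp
      then show False using c1 by (simp add: c0)
    qed (use R_pos in simp)
  qed
  have escape: "filterlim (u \<circ> real_of_ereal) at_top (at_left \<omega>)"
    unfolding filterlim_at_top_dense
  proof
    fix M
    obtain s where s: "ereal s < \<omega>" "M < u s" using unbounded by blast
    have "M < (u \<circ> real_of_ereal) t" if "ereal s < t" "t < \<omega>" for t
      using that s mono[of s "real_of_ereal t"] by (cases t) auto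
    then show "\<forall>\<^sub>F t in at_left \<omega>. M < (u \<circ> real_of_ereal) t"
      using s(1) by (auto simp: eventually_at_left[OF s(1)])
  qed
  have \<omega>_gt: "-\<infinity> < \<omega>" by (simp add: \<omega>_def)
  have rad_pos: "fps_conv_radius g > 0" if "R \<le> fps_conv_radius g" for g :: "real fps"
    using R_pos that by (rule less_le_trans)
  have decay: "((\<lambda>t. eval_fps g (exp (l * t))) \<longlongrightarrow> 0) at_bot"
    if "R \<le> fps_conv_radius g" "fps_nth g 0 = 0" for g
    using rad_pos[OF that(1)] that(2) l(1) by (rule exp_series_tendsto_0)
  show ?thesis
  proof (rule that[of \<omega> u u' u''])
    show "(u \<longlongrightarrow> 0) at_bot" "(u' \<longlongrightarrow> 0) at_bot" "(u'' \<longlongrightarrow> 0) at_bot"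
      unfolding u_def u'_def u''_def by (intro decay rad; simp add: D_def c0)+
  next
    fix t assume "ereal t < \<omega>"
    note d = deriv[OF this rad(1)] deriv[OF this rad(2)] deriv[OF this rad(3)] third[OF this]
    show "(u has_real_derivative u' t) (at t)"
      using d(1) by (simp only: u_def[abs_def] u'_def)
    show "(u' has_real_derivative u'' t) (at t)"
      using d(2) by (simp only: u'_def[abs_def] u''_def)
    show "(u'' has_real_derivative u t + (u t)\<^sup>2 - A * u'' t - B * u' t) (at t)"
      using d(3) unfolding d(4) by (simp only: u''_def[abs_def])
  qed (fact \<omega>_gt escape)+
qed

section \<open>Maximal orbits escaping to infinity\<close>

text \<open>
  An extension past a finite endpoint would be continuous there, hence bounded nearby, whereas
  the given curve escapes to \<infinity> at that endpoint.
\<close>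

lemma maximal_if_ends_at_infinity:
  assumes curve: "integral_curve F \<alpha> \<omega> \<gamma>"
    and bwd: "\<alpha> = -\<infinity> \<or> backward_end \<alpha> \<gamma> None"
    and fwd: "\<omega> = \<infinity> \<or> forward_end \<omega> \<gamma> None"
  shows "maximal_integral_curve F \<alpha> \<omega> \<gamma>"
  unfolding maximal_integral_curve_def
proof (intro conjI[OF curve] allI impI; elim conjE)
  fix \<alpha>' \<omega>' \<delta>
  assume le: "\<alpha>' \<le> \<alpha>" "\<omega> \<le> \<omega>'" and \<delta>: "integral_curve F \<alpha>' \<omega>' \<delta>"
    and eq: "\<forall>t\<in>einterval \<alpha> \<omega>. \<delta> t = \<gamma> t"
  have "\<alpha> < \<omega>" using curve by (simp add: integral_curve_def)
  have cont: "(\<delta> \<longlongrightarrow> \<delta> T) (at T within S)" if "\<alpha>' < ereal T" "ereal T < \<omega>'" for T S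
  proof -
    have "(\<delta> has_vector_derivative F (\<delta> T)) (at T)"
      using \<delta> that by (simp add: integral_curve_def einterval_iff)
    then have "continuous (at T within S) \<delta>"
      using has_vector_derivative_continuous continuous_at_imp_continuous_within by blast
    then show ?thesis by (simp add: continuous_within)
  qed
  have "\<alpha>' = \<alpha>"
  proof (rule ccontr)
    assume "\<alpha>' \<noteq> \<alpha>"
    with le have "\<alpha>' < \<alpha>" by simp
    then obtain T where T: "\<alpha> = ereal T" using \<open>\<alpha> < \<omega>\<close> by (cases \<alpha>) auto
    obtain c where c: "T < c" "ereal c < \<omega>"
      using ereal_dense2[of "ereal T" \<omega>] \<open>\<alpha> < \<omega>\<close> T by auto
    have "limitin S3 (Some \<circ> (\<gamma> \<circ> real_of_ereal)) None (at_right (ereal T))"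
      using bwd T by (auto simp: backward_end_def o_assoc)
    then have "filterlim \<gamma> at_infinity (at_right T)"
      by (simp add: limitin_S3_None_iff at_right_ereal filterlim_filtermap)
    moreover have "\<forall>\<^sub>F t in at_right T. \<gamma> t = \<delta> t"
      using eventually_at_right_real[OF c(1)]
    proof eventually_elim
      case (elim t)
      then have "ereal t < \<omega>" using c(2) by (meson ereal_less_eq(3) greaterThanLessThan_iff
            le_less_trans less_imp_le)
      then show ?case using elim eq T by (simp add: einterval_iff)
    qed
    ultimately have "filterlim \<delta> at_infinity (at_right T)"
      using filterlim_cong[OF refl refl] by metis
    moreover have "(\<delta> \<longlongrightarrow> \<delta> T) (at_right T)"
      using T \<open>\<alpha>' < \<alpha>\<close> \<open>\<alpha> < \<omega>\<close> le by (intro cont) auto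
    ultimately show False
      using not_tendsto_and_filterlim_at_infinity trivial_limit_at_right_real by blast
  qed
  moreover have "\<omega>' = \<omega>"
  proof (rule ccontr)
    assume "\<omega>' \<noteq> \<omega>"
    with le have "\<omega> < \<omega>'" by simp
    then obtain T where T: "\<omega> = ereal T" using \<open>\<alpha> < \<omega>\<close> by (cases \<omega>) auto
    obtain c where c: "\<alpha> < ereal c" "c < T"
      using ereal_dense2[of \<alpha> "ereal T"] \<open>\<alpha> < \<omega>\<close> T by auto
    have "limitin S3 (Some \<circ> (\<gamma> \<circ> real_of_ereal)) None (at_left (ereal T))"
      using fwd T by (auto simp: forward_end_def o_assoc)
    then have "filterlim \<gamma> at_infinity (at_left T)"
      by (simp add: limitin_S3_None_iff at_left_ereal filterlim_filtermap)
    moreover have "\<forall>\<^sub>F t in at_left T. \<gamma> t = \<delta> t"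
      using eventually_at_left_real[OF c(2)]
    proof eventually_elim
      case (elim t)
      then have "\<alpha> < ereal t" using c(1) by (meson ereal_less_eq(3) greaterThanLessThan_iff
            less_le_trans less_imp_le)
      then show ?case using elim eq T by (simp add: einterval_iff)
    qed
    ultimately have "filterlim \<delta> at_infinity (at_left T)"
      using filterlim_cong[OF refl refl] by metis
    moreover have "(\<delta> \<longlongrightarrow> \<delta> T) (at_left T)"
      using T \<open>\<omega> < \<omega>'\<close> \<open>\<alpha> < \<omega>\<close> le by (intro cont) auto
    ultimately show False
      using not_tendsto_and_filterlim_at_infinity trivial_limit_at_left_real by blast
  qed
  ultimately show "\<alpha>' = \<alpha> \<and> \<omega>' = \<omega>" by blast
qed

section \<open>The two orbits of the Genesio--Tesi system\<close>

lemma filterlim_at_infinity_component: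
  fixes g :: "'b \<Rightarrow> real ^ 'n"
  assumes "filterlim h at_top G" "\<And>t. \<bar>g t $ i\<bar> \<ge> h t"
  shows "filterlim g at_infinity G"
proof -
  have "filterlim (\<lambda>t. norm (g t)) at_top G"
    by (rule filterlim_at_top_mono[OF assms(1)])
      (use assms(2) component_le_norm_cart order_trans in \<open>blast intro: always_eventually\<close>)
  then show ?thesis by (simp add: filterlim_at_infinity_conv_norm_at_top)
qed

text \<open>In this form the rules for sums and scalar multiples give limits and derivatives.\<close>

lemma vector_3_conv_axis:
  "(vector [x, y, z] :: real^3) = x *\<^sub>R axis 1 1 + y *\<^sub>R axis 2 1 + z *\<^sub>R axis 3 1"
  by (simp add: vec_eq_iff forall_3 axis_def)

lemma has_vector_derivative_vector_3:
  assumes "(x has_real_derivative x') (at t)" "(y has_real_derivative y') (at t)"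
    "(z has_real_derivative z') (at t)"
  shows "((\<lambda>t. vector [x t, y t, z t] :: real^3) has_vector_derivative vector [x', y', z']) (at t)"
  unfolding vector_3_conv_axis
  by (auto intro!: derivative_eq_intros assms)

lemma tendsto_vector_3:
  assumes "(x \<longlongrightarrow> x0) G" "(y \<longlongrightarrow> y0) G" "(z \<longlongrightarrow> z0) G"
  shows "((\<lambda>t. vector [x t, y t, z t] :: real^3) \<longlongrightarrow> vector [x0, y0, z0]) G"
  unfolding vector_3_conv_axis by (intro tendsto_intros assms)

lemma Genesio_Tesi_vector:
  "Genesio_Tesi a b (vector [x, y, z]) = vector [y, z, - a * z - b * y - x * (1 + x)]"
  by (simp add: Genesio_Tesi_def)

lemma Genesio_Tesi_zeros:
  "{p. Genesio_Tesi a b p = 0} = {vector [-1, 0, 0], vector [0, 0, 0]}"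
proof -
  have "Genesio_Tesi a b p = 0 \<longleftrightarrow> p = vector [-1, 0, 0] \<or> p = vector [0, 0, 0]" for p
    by (auto simp: Genesio_Tesi_def Let_def vec_eq_iff forall_3 add_eq_0_iff)
  then show ?thesis by auto
qed

text \<open>
  The linearisation at this point has a positive eigenvalue, and the orbit leaves the point along its
  eigenvector on the side x < -1, where the quadratic term drives it further away.
\<close>

lemma unstable_orbit_to_infinity:
  "connected_to_infinity (Genesio_Tesi a b) (vector [-1, 0, 0])"
proof -
  obtain \<omega> u u' u'' where *: "-\<infinity> < \<omega>"
    "\<And>t. ereal t < \<omega> \<Longrightarrow> (u has_real_derivative u' t) (at t)"
    "\<And>t. ereal t < \<omega> \<Longrightarrow> (u' has_real_derivative u'' t) (at t)"
    "\<And>t. ereal t < \<omega> \<Longrightarrow> (u'' has_real_derivative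
        u t + (u t)\<^sup>2 - a * u'' t - b * u' t) (at t)"
    "(u \<longlongrightarrow> 0) at_bot" "(u' \<longlongrightarrow> 0) at_bot" "(u'' \<longlongrightarrow> 0) at_bot"
    "filterlim (u \<circ> real_of_ereal) at_top (at_left \<omega>)"
    by (rule unbounded_exponential_solution[of a b]) blast
  define \<gamma> :: "real \<Rightarrow> real^3" where "\<gamma> t = vector [- 1 - u t, - u' t, - u'' t]" for t
  have curve: "integral_curve (Genesio_Tesi a b) (-\<infinity>) \<omega> \<gamma>"
    unfolding integral_curve_def
  proof (intro conjI *(1) ballI)
    fix t assume "t \<in> einterval (-\<infinity>) \<omega>"
    then have "ereal t < \<omega>" by (simp add: einterval_iff)
    then have "(\<gamma> has_vector_derivative
        vector [- u' t, - u'' t, - (u t + (u t)\<^sup>2 - a * u'' t - b * u' t)]) (at t)"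
      unfolding \<gamma>_def
      by (intro has_vector_derivative_vector_3) (auto intro!: derivative_eq_intros *)
    then show "(\<gamma> has_vector_derivative Genesio_Tesi a b (\<gamma> t)) (at t)"
      by (simp add: \<gamma>_def Genesio_Tesi_vector algebra_simps power2_eq_square)
  qed
  have "(\<gamma> \<longlongrightarrow> vector [- 1 - 0, - 0, - 0]) at_bot"
    unfolding \<gamma>_def by (intro tendsto_vector_3 tendsto_intros *)
  then have start: "backward_end (-\<infinity>) \<gamma> (Some (vector [-1, 0, 0]))"
    by (simp add: backward_end_def o_assoc[symmetric] limitin_S3_Some_iff ereal_tendsto_simps)
  have "filterlim (\<gamma> \<circ> real_of_ereal) at_infinity (at_left \<omega>)"
    by (rule filterlim_at_infinity_component[where i = 1, OF *(8)]) (simp add: \<gamma>_def)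
  then have escape: "forward_end \<omega> \<gamma> None"
    by (simp add: forward_end_def o_assoc[symmetric] limitin_S3_None_iff)
  have "maximal_integral_curve (Genesio_Tesi a b) (-\<infinity>) \<omega> \<gamma>"
    using curve escape by (intro maximal_if_ends_at_infinity) auto
  with start escape show ?thesis
    unfolding connected_to_infinity_def using Genesio_Tesi_zeros[of a b] by blast
qed

text \<open>
  The linearisation at the origin has a negative eigenvalue, and the orbit arrives along its
  eigenvector. Reversing time exchanges the two ends and changes the sign of the odd-order
  derivatives.
\<close>

lemma stable_orbit_from_infinity:
  "connected_to_infinity (Genesio_Tesi a b) (vector [0, 0, 0])"
proof -
  obtain \<omega> u u' u'' where *: "-\<infinity> < \<omega>"
    "\<And>t. ereal t < \<omega> \<Longrightarrow> (u has_real_derivative u' t) (at t)"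
    "\<And>t. ereal t < \<omega> \<Longrightarrow> (u' has_real_derivative u'' t) (at t)"
    "\<And>t. ereal t < \<omega> \<Longrightarrow> (u'' has_real_derivative
        u t + (u t)\<^sup>2 - (- a) * u'' t - b * u' t) (at t)"
    "(u \<longlongrightarrow> 0) at_bot" "(u' \<longlongrightarrow> 0) at_bot" "(u'' \<longlongrightarrow> 0) at_bot"
    "filterlim (u \<circ> real_of_ereal) at_top (at_left \<omega>)"
    by (rule unbounded_exponential_solution[of "- a" b]) blast
  define \<gamma> :: "real \<Rightarrow> real^3" where "\<gamma> t = vector [u (- t), - u' (- t), u'' (- t)]" for t
  have curve: "integral_curve (Genesio_Tesi a b) (- \<omega>) \<infinity> \<gamma>"
    unfolding integral_curve_def
  proof (intro conjI ballI)
    show "- \<omega> < \<infinity>" using *(1) by (cases \<omega>) auto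
    fix t assume "t \<in> einterval (- \<omega>) \<infinity>"
    then have t: "ereal (- t) < \<omega>"
      by (cases \<omega>) (auto simp: einterval_iff)
    have neg: "((\<lambda>t. - t) has_real_derivative - 1) (at t)"
      by (auto intro!: derivative_eq_intros)
    have "(\<gamma> has_vector_derivative
        vector [u' (- t) * - 1, - (u'' (- t) * - 1),
          (u (- t) + (u (- t))\<^sup>2 - (- a) * u'' (- t) - b * u' (- t)) * - 1]) (at t)"
      unfolding \<gamma>_def
      by (intro has_vector_derivative_vector_3 DERIV_minus DERIV_chain2[OF _ neg] *(2,3,4) t)
    then show "(\<gamma> has_vector_derivative Genesio_Tesi a b (\<gamma> t)) (at t)"
      by (simp add: \<gamma>_def Genesio_Tesi_vector algebra_simps power2_eq_square)
  qed
  have "((\<lambda>t. \<gamma> t) \<longlongrightarrow> vector [0, - 0, 0]) at_top"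
    unfolding \<gamma>_def
    by (intro tendsto_vector_3 tendsto_minus
        filterlim_compose[OF *(5) filterlim_uminus_at_bot_at_top]
        filterlim_compose[OF *(6) filterlim_uminus_at_bot_at_top]
        filterlim_compose[OF *(7) filterlim_uminus_at_bot_at_top])
  then have target: "forward_end \<infinity> \<gamma> (Some (vector [0, 0, 0]))"
    by (simp add: forward_end_def o_assoc[symmetric] limitin_S3_Some_iff ereal_tendsto_simps)
  have reflect: "filterlim uminus (at_left \<omega>) (at_right (- \<omega>))"
    unfolding filterlim_def le_filter_def eventually_filtermap
  proof (intro allI impI)
    fix Q assume Q: "eventually Q (at_left \<omega>)"
    obtain s where s: "s < \<omega>" "\<And>t. s < t \<Longrightarrow> t < \<omega> \<Longrightarrow> Q t"
      using Q eventually_at_left[OF *(1)] by auto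
    have "- \<omega> < - s" using s(1) by simp
    then show "\<forall>\<^sub>F t in at_right (- \<omega>). Q (- t)"
      unfolding eventually_at_right[OF \<open>- \<omega> < - s\<close>]
      by (intro exI[of _ "- s"]) (auto intro!: s(2) simp: ereal_less_uminus_reorder ereal_uminus_less_reorder)
  qed
  have "filterlim (\<gamma> \<circ> real_of_ereal) at_infinity (at_right (- \<omega>))"
    by (rule filterlim_at_infinity_component[where i = 1, OF filterlim_compose[OF *(8) reflect]])
      (simp add: \<gamma>_def)
  then have escape: "backward_end (- \<omega>) \<gamma> None"
    by (simp add: backward_end_def o_assoc[symmetric] limitin_S3_None_iff)
  have "maximal_integral_curve (Genesio_Tesi a b) (- \<omega>) \<infinity> \<gamma>"
    using curve escape by (intro maximal_if_ends_at_infinity) auto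
  with target escape show ?thesis
    unfolding connected_to_infinity_def using Genesio_Tesi_zeros[of a b] by blast
qed

theorem mainTheorem4:
  fixes a b :: real
  assumes "a > 0" and "b > 0"
  shows "{p. Genesio_Tesi a b p = 0} = {vector [-1, 0, 0], vector [0, 0, 0]} \<and>
    connected_to_infinity (Genesio_Tesi a b) (vector [-1, 0, 0]) \<and>
    connected_to_infinity (Genesio_Tesi a b) (vector [0, 0, 0])"
  by (intro conjI Genesio_Tesi_zeros unstable_orbit_to_infinity stable_orbit_from_infinity)

end
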